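(* Let $\alpha\in\mathbb{N}_0$ and $\beta>-1$. For sufficiently smooth functions $y$ on $(-1,1)$, the Jacobi-type differential operator $$L_{2\alpha+4,x}^{\alpha,\beta}y(x)=\frac{x-1}{(x+1)^{\beta}}D_x^{\alpha+2}\Big\{(x+1)^{\alpha+\beta+2}D_x^{\alpha+2}\big[(x-1)^{\alpha+1}y(x)\big]\Big\}$$ can be factorized by $$L_{2\alpha+4,x}^{\alpha,\beta}y(x)=\prod_{j=0}^{\alpha+1}\Big\{L_{2,x}^{2j-1,\beta}-\frac{4j}{x-1}+j(j+\beta)\Big\}y(x),$$ where $$L_{2,x}^{2j-1,\beta}=(x^2-1)D_x^2+[2j-\beta-1+(2j+\beta+1)x]D_x,\qquad j=0,1,\dots,\alpha+1.$$ Here the product $\prod_{j=0}^{\alpha+1}$ is understood as the successive application of each second-order operator to the respective function on its right-hand side, in the order from $j=0$ (applied first) to $j=\alpha+1$ (applied last).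
   Context: $\mathbb{N}_0=\{0,1,2,\dots\}$; $D_x^i$ is $i$-fold differentiation with respect to $x$. The identity is on $-1<x<1$. *)

theory Defs
  imports "HOL-Analysis.Analysis"
begin

text \<open>
  Functions on $(-1,1)$ are represented by total functions on the reals. All operators below are
  local, so on $(-1,1)$ they do not depend on the values outside this open interval.
\<close>

definition jacobi_type_op :: "nat \<Rightarrow> real \<Rightarrow> (real \<Rightarrow> real) \<Rightarrow> real \<Rightarrow> real" where
  "jacobi_type_op \<alpha> \<beta> y = (\<lambda>x. (x - 1) / (x + 1) powr \<beta> *
     (deriv ^^ (\<alpha> + 2)) (\<lambda>t. (t + 1) powr (real \<alpha> + \<beta> + 2) *
        (deriv ^^ (\<alpha> + 2)) (\<lambda>s. (s - 1) ^ (\<alpha> + 1) * y s) t) x)"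

text \<open>The argument \<open>j\<close> stands for the first Jacobi parameter $2j-1$: this is $L_{2,x}^{2j-1,\beta}$.\<close>

definition jacobi_op :: "nat \<Rightarrow> real \<Rightarrow> (real \<Rightarrow> real) \<Rightarrow> real \<Rightarrow> real" where
  "jacobi_op j \<beta> f = (\<lambda>x. (x^2 - 1) * (deriv ^^ 2) f x +
     (2 * real j - \<beta> - 1 + (2 * real j + \<beta> + 1) * x) * deriv f x)"

definition factor_op :: "nat \<Rightarrow> real \<Rightarrow> (real \<Rightarrow> real) \<Rightarrow> real \<Rightarrow> real" where
  "factor_op j \<beta> f = (\<lambda>x. jacobi_op j \<beta> f x - 4 * real j / (x - 1) * f x +
     real j * (real j + \<beta>) * f x)"

text \<open>\<open>factor_prod n \<beta>\<close> composes the factors $j = 0, \dots, n-1$; the factor $j=0$ is innermost.\<close>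

primrec factor_prod :: "nat \<Rightarrow> real \<Rightarrow> (real \<Rightarrow> real) \<Rightarrow> real \<Rightarrow> real" where
  "factor_prod 0 \<beta> y = y"
| "factor_prod (Suc n) \<beta> y = factor_op n \<beta> (factor_prod n \<beta> y)"

end

theory Submission
  imports Defs
begin

text \<open>
  Write $D$ for differentiation, $u = x - 1$, $v = x + 1$ and $z = y / u$. The factorization is the
  case $m = \alpha + 2$ of
  $$F_{m-1} \cdots F_0\, y = u\, v^{-\beta} D^m \{ v^{m+\beta} D^m [u^m z] \},$$
  where $F_j$ is the $j$-th second-order factor; for $m \geq 1$ the innermost function is
  $u^{m-1} y$. Dividing $y$ by $u$ lets the formula start at $m = 0$, where it reads
  $y = u\,v^{-\beta} v^\beta\, y / u$.

  The induction step compares two expressions in $h = D^m \{v^{m+\beta} D^m [u^m z]\}$.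
  Applying $F_m$ to $u\,v^{-\beta} h$ gives $u\,v^{-\beta} T_m h$ with
  $$T_m = u v D^2 + [(1 - \beta) u + 2 (m+1) v] D + (m+1)(m+1-\beta);$$
  all terms with negative powers of $u$ or extra negative powers of $v$ cancel
  (\<open>factor_op_conjugate\<close>). On the other hand, raising $m$ to $m + 1$ in
  $D^m \{v^{m+\beta} D^m [u^m z]\}$ inserts one factor $u$, one factor $v$ and two derivatives.
  These are moved outwards by the Leibniz rule, which has only two terms because one factor is
  linear, and the result is again $T_m h$ (\<open>funpow_deriv_weighted_raise\<close>). So no binomial
  expansion ever occurs.

  Each step costs two derivatives of $y$, so $2m$-fold differentiability suffices for $m$ factors.
\<close>

section \<open>Finitely many derivatives on an open set\<close>

definition times_differentiable_on :: "nat \<Rightarrow> (real \<Rightarrow> real) \<Rightarrow> real set \<Rightarrow> bool" where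
  "times_differentiable_on k f S \<longleftrightarrow> (\<forall>i<k. (deriv ^^ i) f differentiable_on S)"

lemma times_differentiable_on_Suc:
  "times_differentiable_on (Suc k) f S \<longleftrightarrow>
     f differentiable_on S \<and> times_differentiable_on k (deriv f) S"
  unfolding times_differentiable_on_def
  by (auto simp: less_Suc_eq_0_disj funpow_swap1 simp flip: funpow.simps(2)
      simp del: funpow.simps) (auto simp: funpow_swap1)

lemma times_differentiable_on_mono:
  "times_differentiable_on k f S \<Longrightarrow> l \<le> k \<Longrightarrow> times_differentiable_on l f S"
  by (auto simp: times_differentiable_on_def)

lemma times_differentiable_on_funpow_deriv:
  "times_differentiable_on (k + l) f S \<Longrightarrow> times_differentiable_on k ((deriv ^^ l) f) S"
  by (auto simp: times_differentiable_on_def funpow_add[symmetric, THEN fun_cong, unfolded comp_apply])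

lemma has_deriv_funpow_deriv:
  assumes "times_differentiable_on k f S" "i < k" "open S" "x \<in> S"
  shows "((deriv ^^ i) f has_real_derivative (deriv ^^ Suc i) f x) (at x)"
proof -
  have "(deriv ^^ i) f differentiable at x"
    using assms by (auto simp: times_differentiable_on_def differentiable_on_eq_differentiable_at)
  then have "((deriv ^^ i) f has_real_derivative deriv ((deriv ^^ i) f) x) (at x)"
    by (simp add: DERIV_deriv_iff_real_differentiable)
  then show ?thesis by simp
qed

lemma deriv_cong_open:
  fixes f g :: "real \<Rightarrow> real"
  assumes "open S" "\<And>x. x \<in> S \<Longrightarrow> f x = g x" "x \<in> S"
  shows "deriv f x = deriv g x"
  by (rule deriv_cong_ev) (use assms eventually_nhds_in_open[of S x] in \<open>auto elim: eventually_mono\<close>)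

lemma funpow_deriv_cong_open:
  fixes f g :: "real \<Rightarrow> real"
  assumes "open S" "\<And>x. x \<in> S \<Longrightarrow> f x = g x" "x \<in> S"
  shows "(deriv ^^ k) f x = (deriv ^^ k) g x"
  using assms(3)
proof (induction k arbitrary: x)
  case 0
  then show ?case using assms(2) by simp
next
  case (Suc k)
  then show ?case using deriv_cong_open[OF assms(1), of "(deriv ^^ k) f" "(deriv ^^ k) g"] by simp
qed

lemma times_differentiable_on_cong:
  assumes "open S" "\<And>x. x \<in> S \<Longrightarrow> f x = g x" "times_differentiable_on k f S"
  shows "times_differentiable_on k g S"
proof -
  have "(deriv ^^ i) g differentiable_on S" if "(deriv ^^ i) f differentiable_on S" for i
    unfolding differentiable_on_def
  proof
    fix x assume "x \<in> S"
    with that have "(deriv ^^ i) f differentiable (at x within S)"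
      by (simp add: differentiable_on_def)
    then show "(deriv ^^ i) g differentiable (at x within S)"
      using \<open>x \<in> S\<close> funpow_deriv_cong_open[OF assms(1,2)]
      by (rule differentiable_transform_within[OF _ zero_less_one])
  qed
  then show ?thesis
    using assms(3) by (simp add: times_differentiable_on_def)
qed

text \<open>
  The derivative may be given by a formula valid only on \<open>S\<close>. Closure under sums, products and
  reciprocals follows from this by induction on the order, for all functions at once, where the formula for the
  derivative is built from functions to which the induction hypothesis applies.
\<close>

lemma times_differentiable_on_SucI:
  assumes "open S" "\<And>x. x \<in> S \<Longrightarrow> (f has_real_derivative f' x) (at x)"
    and "times_differentiable_on k f' S"
  shows "times_differentiable_on (Suc k) f S"
proof -
  have "f differentiable_on S"
    using assms(1,2)
    by (auto simp: differentiable_on_eq_differentiable_at real_differentiable_def)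
  moreover have "times_differentiable_on k (deriv f) S"
    by (rule times_differentiable_on_cong[OF assms(1) _ assms(3)])
       (use assms(2) DERIV_imp_deriv in fastforce)
  ultimately show ?thesis
    by (simp add: times_differentiable_on_Suc)
qed

lemma times_differentiable_on_SucE:
  assumes "times_differentiable_on (Suc k) f S" "open S" "x \<in> S"
  shows "(f has_real_derivative deriv f x) (at x)"
  using has_deriv_funpow_deriv[OF assms(1) _ assms(2,3), of 0] by simp

lemma times_differentiable_on_add:
  assumes "open S" "times_differentiable_on k f S" "times_differentiable_on k g S"
  shows "times_differentiable_on k (\<lambda>x. f x + g x) S"
  using assms(2,3)
proof (induction k arbitrary: f g)
  case 0
  then show ?case by (simp add: times_differentiable_on_def)
next
  case (Suc k)
  show ?case
  proof (rule times_differentiable_on_SucI[OF assms(1)])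
    show "((\<lambda>x. f x + g x) has_real_derivative deriv f x + deriv g x) (at x)" if "x \<in> S" for x
      by (intro DERIV_add times_differentiable_on_SucE[OF Suc.prems(1) assms(1) that]
          times_differentiable_on_SucE[OF Suc.prems(2) assms(1) that])
    show "times_differentiable_on k (\<lambda>x. deriv f x + deriv g x) S"
      using Suc by (simp add: times_differentiable_on_Suc)
  qed
qed

lemma times_differentiable_on_mult:
  assumes "open S" "times_differentiable_on k f S" "times_differentiable_on k g S"
  shows "times_differentiable_on k (\<lambda>x. f x * g x) S"
  using assms(2,3)
proof (induction k arbitrary: f g)
  case 0
  then show ?case by (simp add: times_differentiable_on_def)
next
  case (Suc k)
  show ?case
  proof (rule times_differentiable_on_SucI[OF assms(1)])
    show "((\<lambda>x. f x * g x) has_real_derivative f x * deriv g x + deriv f x * g x) (at x)"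
      if "x \<in> S" for x
      using DERIV_mult'[OF times_differentiable_on_SucE[OF Suc.prems(1) assms(1) that]
          times_differentiable_on_SucE[OF Suc.prems(2) assms(1) that]] .
    have "times_differentiable_on k f S" "times_differentiable_on k g S"
      using Suc.prems times_differentiable_on_mono[of "Suc k"] by auto
    then show "times_differentiable_on k (\<lambda>x. f x * deriv g x + deriv f x * g x) S"
      using Suc by (intro times_differentiable_on_add[OF assms(1)] Suc.IH)
        (simp_all add: times_differentiable_on_Suc)
  qed
qed

lemma times_differentiable_on_const:
  "times_differentiable_on k (\<lambda>x. c) S"
proof -
  have "(deriv ^^ i) (\<lambda>x. c) = (\<lambda>x. if i = 0 then c else 0)" for i
    by (induction i) auto
  then show ?thesis
    by (simp add: times_differentiable_on_def)
qed

lemma times_differentiable_on_shift: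
  assumes "open S"
  shows "times_differentiable_on k (\<lambda>x. x + c) S"
proof (cases k)
  case (Suc l)
  show ?thesis unfolding Suc
    by (rule times_differentiable_on_SucI[OF assms _ times_differentiable_on_const[of _ 1]])
       (auto intro!: derivative_eq_intros)
qed (simp add: times_differentiable_on_def)

lemma times_differentiable_on_power:
  assumes "open S" "times_differentiable_on k f S"
  shows "times_differentiable_on k (\<lambda>x. f x ^ n) S"
  by (induction n)
     (simp_all add: times_differentiable_on_const times_differentiable_on_mult[OF assms(1,2)])

lemma times_differentiable_on_inverse:
  assumes "open S" "times_differentiable_on k f S" "\<And>x. x \<in> S \<Longrightarrow> f x \<noteq> 0"
  shows "times_differentiable_on k (\<lambda>x. inverse (f x)) S"
  using assms(2)
proof (induction k)
  case 0
  then show ?case by (simp add: times_differentiable_on_def)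
next
  case (Suc k)
  then have inv: "times_differentiable_on k (\<lambda>x. inverse (f x)) S"
    and f': "times_differentiable_on k (deriv f) S"
    using times_differentiable_on_mono[of "Suc k" f S k] by (auto simp: times_differentiable_on_Suc)
  show ?case
  proof (rule times_differentiable_on_SucI[OF assms(1)])
    show "((\<lambda>x. inverse (f x)) has_real_derivative
        - 1 * (inverse (f x) * (deriv f x * inverse (f x)))) (at x)" if "x \<in> S" for x
      using DERIV_inverse'[OF times_differentiable_on_SucE[OF Suc.prems assms(1) that] assms(3)[OF that]]
      by (simp add: mult.assoc)
    show "times_differentiable_on k
        (\<lambda>x. - 1 * (inverse (f x) * (deriv f x * inverse (f x)))) S"
      by (intro times_differentiable_on_mult[OF assms(1)] times_differentiable_on_const inv f')
  qed
qed

lemma times_differentiable_on_shift_powr: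
  assumes "open S" "\<And>x. x \<in> S \<Longrightarrow> x + c > 0"
  shows "times_differentiable_on k (\<lambda>x. (x + c) powr a) S"
proof (induction k arbitrary: a)
  case 0
  then show ?case by (simp add: times_differentiable_on_def)
next
  case (Suc k)
  show ?case
  proof (rule times_differentiable_on_SucI[OF assms(1)])
    show "((\<lambda>x. (x + c) powr a) has_real_derivative a * (x + c) powr (a - 1)) (at x)"
      if "x \<in> S" for x
      using assms(2)[OF that] by (auto intro!: derivative_eq_intros)
    show "times_differentiable_on k (\<lambda>x. a * (x + c) powr (a - 1)) S"
      by (intro times_differentiable_on_mult[OF assms(1)] times_differentiable_on_const Suc.IH)
  qed
qed

section \<open>Iterated derivatives of sums and of products with a linear function\<close>

lemma funpow_deriv_add:
  assumes "open S" "times_differentiable_on k f S" "times_differentiable_on k g S" "x \<in> S"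
  shows "(deriv ^^ k) (\<lambda>t. f t + g t) x = (deriv ^^ k) f x + (deriv ^^ k) g x"
  using assms(2-4)
proof (induction k arbitrary: x)
  case (Suc k)
  have "times_differentiable_on k f S" "times_differentiable_on k g S"
    using Suc.prems times_differentiable_on_mono[of "Suc k"] by auto
  then have "deriv ((deriv ^^ k) (\<lambda>t. f t + g t)) x
      = deriv (\<lambda>t. (deriv ^^ k) f t + (deriv ^^ k) g t) x"
    by (intro deriv_cong_open[OF assms(1) _ Suc.prems(3)] Suc.IH)
  also have "\<dots> = (deriv ^^ Suc k) f x + (deriv ^^ Suc k) g x"
    by (intro DERIV_imp_deriv DERIV_add has_deriv_funpow_deriv[OF Suc.prems(1)]
        has_deriv_funpow_deriv[OF Suc.prems(2)] assms(1) Suc.prems(3)) auto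
  finally show ?case by simp
qed simp

lemma funpow_deriv_cmult:
  assumes "open S" "times_differentiable_on k f S" "x \<in> S"
  shows "(deriv ^^ k) (\<lambda>t. c * f t) x = c * (deriv ^^ k) f x"
  using assms(2,3)
proof (induction k arbitrary: x)
  case (Suc k)
  have "times_differentiable_on k f S"
    using Suc.prems times_differentiable_on_mono[of "Suc k"] by auto
  then have "deriv ((deriv ^^ k) (\<lambda>t. c * f t)) x = deriv (\<lambda>t. c * (deriv ^^ k) f t) x"
    by (intro deriv_cong_open[OF assms(1) _ Suc.prems(2)] Suc.IH)
  also have "\<dots> = c * (deriv ^^ Suc k) f x"
    by (intro DERIV_imp_deriv DERIV_cmult has_deriv_funpow_deriv[OF Suc.prems(1)]
        assms(1) Suc.prems(2)) auto
  finally show ?case by simp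
qed simp

text \<open>
  In the Leibniz formula all but two terms vanish, since the second derivative of a linear function
  is zero. For \<open>k = 0\<close> the truncated order \<open>k - 1\<close> is harmless because its coefficient
  is zero.
\<close>

lemma funpow_deriv_shift_mult:
  assumes "open S" "times_differentiable_on k f S" "x \<in> S"
  shows "(deriv ^^ k) (\<lambda>t. (t + c) * f t) x =
    (x + c) * (deriv ^^ k) f x + real k * (deriv ^^ (k - 1)) f x"
  using assms(2,3)
proof (induction k arbitrary: x)
  case (Suc k)
  have k: "times_differentiable_on k f S"
    using Suc.prems times_differentiable_on_mono[of "Suc k"] by auto
  note D = has_deriv_funpow_deriv[OF Suc.prems(1) _ assms(1) Suc.prems(2)]
  have lower: "((\<lambda>t. real k * (deriv ^^ (k - 1)) f t) has_real_derivative
      real k * (deriv ^^ k) f x) (at x)"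
    using DERIV_cmult[OF D[of "k - 1"], of "real k"] by (cases k) simp_all
  have "deriv ((deriv ^^ k) (\<lambda>t. (t + c) * f t)) x
      = deriv (\<lambda>t. (t + c) * (deriv ^^ k) f t + real k * (deriv ^^ (k - 1)) f t) x"
    by (intro deriv_cong_open[OF assms(1) _ Suc.prems(2)] Suc.IH k)
  also have "\<dots> = (x + c) * (deriv ^^ Suc k) f x + real (Suc k) * (deriv ^^ k) f x"
  proof (rule DERIV_imp_deriv)
    have "((\<lambda>t. t + c) has_real_derivative 1) (at x)"
      by (auto intro!: derivative_eq_intros)
    from DERIV_add[OF DERIV_mult'[OF this D[of k]] lower]
    show "((\<lambda>t. (t + c) * (deriv ^^ k) f t + real k * (deriv ^^ (k - 1)) f t) has_real_derivative
        (x + c) * (deriv ^^ Suc k) f x + real (Suc k) * (deriv ^^ k) f x) (at x)"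
      by (simp add: algebra_simps)
  qed
  finally show ?case by simp
qed simp

section \<open>The second-order operator behind one induction step\<close>

lemma factor_op_cong_open:
  assumes "open S" "\<And>x. x \<in> S \<Longrightarrow> f x = g x" "x \<in> S"
  shows "factor_op j \<beta> f x = factor_op j \<beta> g x"
  using funpow_deriv_cong_open[OF assms, where k = 2] deriv_cong_open[OF assms] assms(2,3)
  by (simp add: factor_op_def jacobi_op_def)

text \<open>
  This is the operator $T_m$ of the introduction. It is both the conjugate of the factor with index
  \<open>m\<close> by $(x-1)(x+1)^{-\beta}$ and the effect of raising \<open>m\<close> in
  $D^m \{(x+1)^{m+\beta} D^m [\cdot]\}$.
\<close>

abbreviation intertwined_op :: "nat \<Rightarrow> real \<Rightarrow> (real \<Rightarrow> real) \<Rightarrow> real \<Rightarrow> real" where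
  "intertwined_op m \<beta> h x \<equiv> (x - 1) * (x + 1) * (deriv ^^ 2) h x
     + ((1 - \<beta>) * (x - 1) + 2 * (real m + 1) * (x + 1)) * deriv h x
     + (real m + 1) * (real m + 1 - \<beta>) * h x"

text \<open>
  The coefficient of \<open>deriv f\<close> in the factor takes the value $4m$ at $x = 1$. Hence the term with
  $-4m/(x-1)$ cancels against the derivative of the prefactor $x - 1$, and what remains is divisible
  by $x - 1$. The terms with $1/(x+1)$ that come from differentiating the power of $x + 1$ combine
  to a multiple of $(x - 1)(x + 1)/(x + 1)$.
\<close>

lemma factor_op_conjugate:
  assumes "open S" "S \<subseteq> {-1<..<1}" "times_differentiable_on 2 h S" "x \<in> S"
  shows "factor_op m \<beta> (\<lambda>t. (t - 1) * (t + 1) powr (- \<beta>) * h t) x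
     = (x - 1) * (x + 1) powr (- \<beta>) * intertwined_op m \<beta> h x"
proof -
  define E where "E = (\<lambda>t::real. (t + 1) powr (- \<beta>))"
  define f where "f = (\<lambda>t. (t - 1) * E t * h t)"
  define f1 where "f1 = (\<lambda>t. E t * (h t + (t - 1) * deriv h t - \<beta> * (t - 1) * h t / (t + 1)))"
  define f2 where "f2 = (\<lambda>t. E t * (2 * deriv h t + (t - 1) * (deriv ^^ 2) h t
      - 2 * \<beta> * (h t + (t - 1) * deriv h t) / (t + 1)
      + \<beta> * (\<beta> + 1) * (t - 1) * h t / (t + 1)^2))"
  have E': "(E has_real_derivative - \<beta> * E t / (t + 1)) (at t)" if "t \<in> S" for t
  proof -
    have "t + 1 > 0" using that assms(2) by auto
    then show ?thesis unfolding E_def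
      by (auto intro!: derivative_eq_intros simp: powr_diff)
  qed
  have h': "(h has_real_derivative deriv h t) (at t)"
    and h'': "(deriv h has_real_derivative (deriv ^^ 2) h t) (at t)" if "t \<in> S" for t
    using has_deriv_funpow_deriv[OF assms(3) _ assms(1) that, of 0]
      has_deriv_funpow_deriv[OF assms(3) _ assms(1) that, of 1] by (auto simp: numeral_2_eq_2)
  have d1: "(f has_real_derivative f1 t) (at t)" if "t \<in> S" for t
    unfolding f_def f1_def using that assms(2)
    by (auto intro!: derivative_eq_intros E' h') (auto simp: field_simps)
  have d2: "(f1 has_real_derivative f2 t) (at t)" if "t \<in> S" for t
  proof -
    have "t + 1 \<noteq> 0" using that assms(2) by auto
    then show ?thesis
      unfolding f1_def f2_def
      by (auto intro!: derivative_eq_intros E'[OF that] h'[OF that] h''[OF that])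
        (simp add: divide_simps, algebra)
  qed
  have "deriv f x = f1 x"
    using d1[OF assms(4)] by (rule DERIV_imp_deriv)
  moreover have "(deriv ^^ 2) f x = f2 x"
    using deriv_cong_open[OF assms(1) DERIV_imp_deriv[OF d1] assms(4)]
      DERIV_imp_deriv[OF d2[OF assms(4)]] by (simp add: numeral_2_eq_2)
  moreover have "x + 1 \<noteq> 0" "x - 1 \<noteq> 0" using assms(2,4) by auto
  ultimately have "factor_op m \<beta> f x = (x - 1) * E x * intertwined_op m \<beta> h x"
    unfolding factor_op_def jacobi_op_def
    by (simp add: f_def f1_def f2_def divide_simps) algebra
  then show ?thesis by (simp add: f_def E_def)
qed

text \<open>
  Let $w = D^m z$ and $g = v^{m+\beta} w$, so that $h = D^m g$. By the Leibniz rule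
  $D^{m+1}[u z] = u w' + (m+1) w$, and expressing $w$ and $w'$ by $g$ and $g'$ absorbs all
  non-integer powers:
  $$v^{m+1+\beta} D^{m+1}[u z] = u v g' - (m+\beta) u g + (m+1) v g.$$
  The right-hand side has polynomial coefficients, so $D^{m+1}$ of it is a combination of
  $h$, $h'$ and $h''$ by further uses of the Leibniz rule for linear factors.
\<close>

lemma funpow_deriv_weighted_raise:
  fixes \<beta> :: real
  assumes "open S" "S \<subseteq> {-1<..<1}" "times_differentiable_on (2 * m + 2) z S" "x \<in> S"
  defines "h \<equiv> (deriv ^^ m) (\<lambda>t. (t + 1) powr (real m + \<beta>) * (deriv ^^ m) z t)"
  shows "(deriv ^^ Suc m) (\<lambda>t. (t + 1) powr (real (Suc m) + \<beta>) *
       (deriv ^^ Suc m) (\<lambda>s. (s - 1) * z s) t) x = intertwined_op m \<beta> h x"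
    and "times_differentiable_on 2 h S"
proof -
  define w where "w = (deriv ^^ m) z"
  define g where "g = (\<lambda>t. (t + 1) powr (real m + \<beta>) * w t)"
  have pos: "t + 1 > 0" if "t \<in> S" for t
    using that assms(2) by auto
  have w: "times_differentiable_on (m + 2) w S"
    unfolding w_def by (rule times_differentiable_on_funpow_deriv) (use assms(3) in \<open>simp add: mult_2\<close>)
  have g: "times_differentiable_on (m + 2) g S"
    unfolding g_def
    by (intro times_differentiable_on_mult times_differentiable_on_shift_powr w assms(1) pos)
  have h: "h = (deriv ^^ m) g"
    by (simp add: h_def g_def w_def)
  show "times_differentiable_on 2 h S"
    unfolding h by (rule times_differentiable_on_funpow_deriv) (use g in \<open>simp add: add.commute\<close>)
  have g1: "times_differentiable_on (Suc m) g S" and g': "times_differentiable_on (Suc m) (deriv g) S"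
    using g times_differentiable_on_mono[OF g, of "Suc m"] by (auto simp: times_differentiable_on_Suc)
  have z: "times_differentiable_on (Suc m) z S"
    using assms(3) times_differentiable_on_mono by fastforce
  have inner: "(t + 1) powr (real (Suc m) + \<beta>) * (deriv ^^ Suc m) (\<lambda>s. (s - 1) * z s) t
      = (t + - 1) * ((t + 1) * deriv g t)
        + (- (real m + \<beta>) * ((t + - 1) * g t) + (real m + 1) * ((t + 1) * g t))"
    if t: "t \<in> S" for t
  proof -
    have z': "(deriv ^^ Suc m) (\<lambda>s. (s - 1) * z s) t = (t - 1) * deriv w t + (real m + 1) * w t"
      using funpow_deriv_shift_mult[OF assms(1) z t, of "-1"] by (simp add: w_def)
    have "(w has_real_derivative deriv w t) (at t)"
      using times_differentiable_on_SucE[of "Suc m" w S] w assms(1) t by simp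
    then have "(g has_real_derivative (real m + \<beta>) * (t + 1) powr (real m + \<beta>) / (t + 1) * w t
        + (t + 1) powr (real m + \<beta>) * deriv w t) (at t)"
      unfolding g_def using pos[OF t] by (auto intro!: derivative_eq_intros simp: powr_diff)
    then have "(t + 1) * deriv g t = (real m + \<beta>) * g t
        + (t + 1) * ((t + 1) powr (real m + \<beta>) * deriv w t)"
      using pos[OF t] by (simp add: DERIV_imp_deriv g_def field_simps)
    moreover have "(t + 1) powr (real (Suc m) + \<beta>) = (t + 1) * (t + 1) powr (real m + \<beta>)"
      using pos[OF t] by (simp add: powr_mult_base add.assoc)
    ultimately show ?thesis
      unfolding z' by (simp only: g_def) (simp (no_asm) add: algebra_simps)
  qed
  note shift = times_differentiable_on_mult[OF assms(1) times_differentiable_on_shift[OF assms(1)]]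
  note cmult = times_differentiable_on_mult[OF assms(1) times_differentiable_on_const]
  note add = times_differentiable_on_add[OF assms(1)]
  have h1: "(deriv ^^ Suc m) g t = deriv h t" and h0: "(deriv ^^ m) (deriv g) t = deriv h t"
    and h2: "(deriv ^^ Suc m) (deriv g) t = (deriv ^^ 2) h t"  for t
    by (simp_all add: h funpow_swap1 numeral_2_eq_2)
  \<comment> \<open>Both sides vanish for \<open>m = 0\<close>; the factor \<open>real m\<close> is what makes this true in that case.\<close>
  have low: "real m * (deriv ^^ (m - 1)) (deriv g) t = real m * h t" for t
    by (cases m) (simp_all add: h funpow_swap1)
  have "(deriv ^^ Suc m) (\<lambda>t. (t + 1) powr (real (Suc m) + \<beta>) *
       (deriv ^^ Suc m) (\<lambda>s. (s - 1) * z s) t) x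
     = (deriv ^^ Suc m) (\<lambda>t. (t + - 1) * ((t + 1) * deriv g t)
        + (- (real m + \<beta>) * ((t + - 1) * g t) + (real m + 1) * ((t + 1) * g t))) x"
    by (rule funpow_deriv_cong_open[OF assms(1) inner assms(4)])
  also have "\<dots> = (deriv ^^ Suc m) (\<lambda>t. (t + - 1) * ((t + 1) * deriv g t)) x
      + (- (real m + \<beta>) * (deriv ^^ Suc m) (\<lambda>t. (t + - 1) * g t) x
        + (real m + 1) * (deriv ^^ Suc m) (\<lambda>t. (t + 1) * g t) x)"
    by (simp only: funpow_deriv_add[OF assms(1) shift[OF shift[OF g']]
          add[OF cmult[OF shift[OF g1]] cmult[OF shift[OF g1]]] assms(4)]
        funpow_deriv_add[OF assms(1) cmult[OF shift[OF g1]] cmult[OF shift[OF g1]] assms(4)]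
        funpow_deriv_cmult[OF assms(1) shift[OF g1] assms(4)])
  also have "(deriv ^^ Suc m) (\<lambda>t. (t + - 1) * g t) x = (x - 1) * deriv h x + (real m + 1) * h x"
    using funpow_deriv_shift_mult[OF assms(1) g1 assms(4), of "-1"] h1[of x] by (simp add: h)
  also have "(deriv ^^ Suc m) (\<lambda>t. (t + 1) * g t) x = (x + 1) * deriv h x + (real m + 1) * h x"
    using funpow_deriv_shift_mult[OF assms(1) g1 assms(4), of "1"] h1[of x] by (simp add: h)
  also have "(deriv ^^ Suc m) (\<lambda>t. (t + - 1) * ((t + 1) * deriv g t)) x
      = (x - 1) * (deriv ^^ Suc m) (\<lambda>t. (t + 1) * deriv g t) x
        + (real m + 1) * (deriv ^^ m) (\<lambda>t. (t + 1) * deriv g t) x"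
    using funpow_deriv_shift_mult[OF assms(1) shift[OF g'] assms(4), of "-1" 1]
    by simp
  also have "(deriv ^^ Suc m) (\<lambda>t. (t + 1) * deriv g t) x
      = (x + 1) * (deriv ^^ 2) h x + (real m + 1) * deriv h x"
    using funpow_deriv_shift_mult[OF assms(1) g' assms(4), of 1] h2[of x] h0[of x] by simp
  also have "(deriv ^^ m) (\<lambda>t. (t + 1) * deriv g t) x = (x + 1) * deriv h x + real m * h x"
    using funpow_deriv_shift_mult[OF assms(1) times_differentiable_on_mono[OF g'] assms(4), of m 1]
      h0[of x] low[of x] by simp
  finally show "(deriv ^^ Suc m) (\<lambda>t. (t + 1) powr (real (Suc m) + \<beta>) *
       (deriv ^^ Suc m) (\<lambda>s. (s - 1) * z s) t) x = intertwined_op m \<beta> h x"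
    by (simp add: algebra_simps)
qed

section \<open>The factorization\<close>

text \<open>
  The quotient \<open>y s / (s - 1)\<close> is left unsimplified so that passing from \<open>m\<close> to \<open>Suc m\<close> only
  multiplies the innermost function by \<open>s - 1\<close>, also at \<open>m = 0\<close>.
\<close>

lemma factor_prod_eq:
  assumes "open S" "S \<subseteq> {-1<..<1}" "times_differentiable_on (2 * m) y S" "x \<in> S"
  shows "factor_prod m \<beta> y x = (x - 1) * (x + 1) powr (- \<beta>) *
     (deriv ^^ m) (\<lambda>t. (t + 1) powr (real m + \<beta>) *
        (deriv ^^ m) (\<lambda>s. (s - 1) ^ m * (y s / (s - 1))) t) x"
  using assms(3,4)
proof (induction m arbitrary: x)
  case 0
  have "x - 1 \<noteq> 0" "x + 1 > 0" using 0 assms(2) by auto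
  then show ?case by (simp add: powr_minus)
next
  case (Suc m)
  define z where "z = (\<lambda>s. (s - 1) ^ m * (y s / (s - 1)))"
  define h where "h = (deriv ^^ m) (\<lambda>t. (t + 1) powr (real m + \<beta>) * (deriv ^^ m) z t)"
  have y: "times_differentiable_on (2 * m + 2) y S"
    using Suc.prems(1) by simp
  have "times_differentiable_on (2 * m + 2)
      (\<lambda>s. (s + - 1) ^ m * (y s * inverse (s + - 1))) S"
    using assms(1,2)
    by (intro times_differentiable_on_mult times_differentiable_on_power
        times_differentiable_on_inverse times_differentiable_on_shift y) auto
  then have z: "times_differentiable_on (2 * m + 2) z S"
    by (simp add: z_def divide_inverse)
  have "factor_prod (Suc m) \<beta> y x
      = factor_op m \<beta> (\<lambda>t. (t - 1) * (t + 1) powr (- \<beta>) * h t) x"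
    unfolding factor_prod.simps
    by (rule factor_op_cong_open[OF assms(1) _ Suc.prems(2)])
       (use Suc.IH times_differentiable_on_mono[OF y, of "2 * m"] in \<open>simp add: h_def z_def\<close>)
  also have "\<dots> = (x - 1) * (x + 1) powr (- \<beta>) * intertwined_op m \<beta> h x"
    using factor_op_conjugate[OF assms(1,2) _ Suc.prems(2)]
      funpow_deriv_weighted_raise(2)[OF assms(1,2) z Suc.prems(2)] unfolding h_def by blast
  also have "intertwined_op m \<beta> h x = (deriv ^^ Suc m) (\<lambda>t. (t + 1) powr (real (Suc m) + \<beta>) *
       (deriv ^^ Suc m) (\<lambda>s. (s - 1) * z s) t) x"
    unfolding h_def
    by (rule funpow_deriv_weighted_raise(1)[OF assms(1,2) z Suc.prems(2), symmetric])
  finally show ?case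
    by (simp only: z_def power_Suc mult.assoc)
qed

theorem theorem4p2:
  fixes \<alpha> :: nat and \<beta> :: real and y :: "real \<Rightarrow> real"
  assumes "\<beta> > -1"
    and "\<And>k. k < 2 * \<alpha> + 4 \<Longrightarrow> (deriv ^^ k) y differentiable_on {-1<..<1}"
  shows "\<forall>x\<in>{-1<..<1}. jacobi_type_op \<alpha> \<beta> y x = factor_prod (\<alpha> + 2) \<beta> y x"
proof
  fix x :: real assume x: "x \<in> {-1<..<1}"
  let ?S = "{-1<..<1::real}"
  have y: "times_differentiable_on (2 * (\<alpha> + 2)) y ?S"
    using assms(2) by (simp add: times_differentiable_on_def)
  have "(deriv ^^ (\<alpha> + 2)) (\<lambda>s. (s - 1) ^ (\<alpha> + 1) * y s) t
      = (deriv ^^ (\<alpha> + 2)) (\<lambda>s. (s - 1) ^ (\<alpha> + 2) * (y s / (s - 1))) t" if "t \<in> ?S" for t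
    by (rule funpow_deriv_cong_open[OF _ _ that]) auto
  then have "(deriv ^^ (\<alpha> + 2)) (\<lambda>t. (t + 1) powr (real \<alpha> + \<beta> + 2) *
        (deriv ^^ (\<alpha> + 2)) (\<lambda>s. (s - 1) ^ (\<alpha> + 1) * y s) t) x
      = (deriv ^^ (\<alpha> + 2)) (\<lambda>t. (t + 1) powr (real (\<alpha> + 2) + \<beta>) *
        (deriv ^^ (\<alpha> + 2)) (\<lambda>s. (s - 1) ^ (\<alpha> + 2) * (y s / (s - 1))) t) x"
    by (intro funpow_deriv_cong_open[OF _ _ x]) (auto simp: add_ac simp del: funpow.simps power_Suc)
  then show "jacobi_type_op \<alpha> \<beta> y x = factor_prod (\<alpha> + 2) \<beta> y x"
    using factor_prod_eq[OF _ order_refl y x, of \<beta>]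
    by (simp add: jacobi_type_op_def powr_minus divide_inverse)
qed

end
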